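(* Let $B$ be a finite two-sided skew brace. Then the following conditions are equivalent: (1) $B$ is solvable (as a skew brace); (2) the group $(B,+)$ is solvable; (3) the group $(B,\cdot)$ is solvable.
   Context: A skew brace is a triple $B=(B,+,\cdot)$ such that $(B,+)$ and $(B,\cdot)$ are groups (neither assumed abelian) on the same underlying set and $a\cdot(b+c)=a\cdot b-a+a\cdot c$ for all $a,b,c\in B$. It is two-sided if moreover $(a+b)\cdot c=a\cdot c-c+b\cdot c$ for all $a,b,c\in B$. The two identity elements coincide and are denoted by $0$. For $a\in B$, $\lambda_a(b)=-a+a\cdot b$ defines an automorphism of $(B,+)$. A left ideal of $B$ is a subgroup $I\leq (B,+)$ with $\lambda_b(I)=I$ for every $b\in B$. An ideal of $B$ is a left ideal that is normal in both $(B,+)$ and $(B,\cdot)$. For ideals $I,J$ of $B$, the commutator $[I,J]_B$ is the ideal of $B$ generated by $[I,J]_+\cup[I,J]_\cdot\cup\{\,i\cdot j-(i+j)\mid i\in I,\ j\in J\,\}$, where $[I,J]_+$ and $[I,J]_\cdot$ are the commutator subgroups taken in $(B,+)$ and $(B,\cdot)$. The derived series of $B$ is $\partial^0(B)=B$, $\partial^{n+1}(B)=[\partial^n(B),\partial^n(B)]_B$. The skew brace $B$ is solvable if $\partial^n(B)=0$ for some $n\geq 0$. *)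

theory Defs
  imports "HOL-Algebra.Algebra"
begin

text \<open>
  The record type of rings carries the two operations of a skew brace; the addition
  is not assumed to be commutative. The record has a separate field for each of the two
  identity elements; that they agree is proved in \<open>one_eq_zero\<close> below.
\<close>

locale skew_brace = mult: group B + add: group "add_monoid B"
  for B :: "('a, 'm) ring_scheme" (structure) +
  assumes brace_left_distrib:
    "\<lbrakk> a \<in> carrier B; b \<in> carrier B; c \<in> carrier B \<rbrakk>
      \<Longrightarrow> a \<otimes> (b \<oplus> c) = ((a \<otimes> b) \<ominus> a) \<oplus> (a \<otimes> c)"

locale two_sided_skew_brace = skew_brace +
  assumes brace_right_distrib:
    "\<lbrakk> a \<in> carrier B; b \<in> carrier B; c \<in> carrier B \<rbrakk>
      \<Longrightarrow> (a \<oplus> b) \<otimes> c = ((a \<otimes> c) \<ominus> c) \<oplus> (b \<otimes> c)"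

definition brace_lambda :: "('a, 'm) ring_scheme \<Rightarrow> 'a \<Rightarrow> 'a \<Rightarrow> 'a" where
  "brace_lambda B a b = (\<ominus>\<^bsub>B\<^esub> a) \<oplus>\<^bsub>B\<^esub> (a \<otimes>\<^bsub>B\<^esub> b)"

definition brace_left_ideal :: "('a, 'm) ring_scheme \<Rightarrow> 'a set \<Rightarrow> bool" where
  "brace_left_ideal B I \<longleftrightarrow>
     subgroup I (add_monoid B) \<and> (\<forall>b \<in> carrier B. brace_lambda B b ` I = I)"

definition brace_ideal :: "('a, 'm) ring_scheme \<Rightarrow> 'a set \<Rightarrow> bool" where
  "brace_ideal B I \<longleftrightarrow> brace_left_ideal B I \<and> I \<lhd> add_monoid B \<and> I \<lhd> B"

definition brace_ideal_generated :: "('a, 'm) ring_scheme \<Rightarrow> 'a set \<Rightarrow> 'a set" where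
  "brace_ideal_generated B S = \<Inter> {I. brace_ideal B I \<and> S \<subseteq> I}"

text \<open>For \<open>H = K\<close> this is \<^term>\<open>derived G H\<close>.\<close>

definition commutator_subgroup ::
    "('a, 'm) monoid_scheme \<Rightarrow> 'a set \<Rightarrow> 'a set \<Rightarrow> 'a set" where
  "commutator_subgroup G H K =
     generate G {h \<otimes>\<^bsub>G\<^esub> k \<otimes>\<^bsub>G\<^esub> inv\<^bsub>G\<^esub> h \<otimes>\<^bsub>G\<^esub> inv\<^bsub>G\<^esub> k | h k. h \<in> H \<and> k \<in> K}"

definition brace_commutator :: "('a, 'm) ring_scheme \<Rightarrow> 'a set \<Rightarrow> 'a set \<Rightarrow> 'a set" where
  "brace_commutator B I J =
     brace_ideal_generated B
       (commutator_subgroup (add_monoid B) I J \<union> commutator_subgroup B I J \<union>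
        {(i \<otimes>\<^bsub>B\<^esub> j) \<ominus>\<^bsub>B\<^esub> (i \<oplus>\<^bsub>B\<^esub> j) | i j. i \<in> I \<and> j \<in> J})"

primrec brace_derived_series :: "('a, 'm) ring_scheme \<Rightarrow> nat \<Rightarrow> 'a set" where
  "brace_derived_series B 0 = carrier B"
| "brace_derived_series B (Suc n) =
     brace_commutator B (brace_derived_series B n) (brace_derived_series B n)"

definition brace_solvable :: "('a, 'm) ring_scheme \<Rightarrow> bool" where
  "brace_solvable B \<longleftrightarrow> (\<exists>n. brace_derived_series B n = {\<zero>\<^bsub>B\<^esub>})"

lemma commutator_subgroup_self: "commutator_subgroup G H H = derived G H"
  unfolding commutator_subgroup_def derived_def
  by (rule arg_cong[where f = "generate G"]) blast

context skew_brace
begin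

lemma one_eq_zero: "\<one> = \<zero>"
proof -
  have z: "\<zero> \<in> carrier B" and o: "\<one> \<in> carrier B"
    using add.one_closed by simp_all
  have m: "\<ominus> \<one> \<in> carrier B"
    using add.inv_closed[of "\<one>"] o by (simp add: a_inv_def)
  have "\<one> \<otimes> (\<zero> \<oplus> \<zero>) = ((\<one> \<otimes> \<zero>) \<ominus> \<one>) \<oplus> (\<one> \<otimes> \<zero>)"
    using brace_left_distrib z o by blast
  then have "\<zero> = \<ominus> \<one>"
    using z o m add.l_one[of "\<zero>"] add.r_one[of "\<ominus> \<one>"] add.l_one[of "\<ominus> \<one>"]
    by (simp add: a_minus_def)
  then show ?thesis
    using add.r_inv[of "\<one>"] add.r_one[of "\<one>"] o by (simp add: a_inv_def)
qed

lemma brace_lambda_closed: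
  "\<lbrakk> a \<in> carrier B; b \<in> carrier B \<rbrakk> \<Longrightarrow> brace_lambda B a b \<in> carrier B"
  using add.m_closed[of "\<ominus> a" "a \<otimes> b"] add.inv_closed[of a]
  by (simp add: brace_lambda_def a_inv_def)

lemma inj_on_brace_lambda:
  assumes "a \<in> carrier B" shows "inj_on (brace_lambda B a) (carrier B)"
proof (rule inj_onI)
  fix x y assume xy: "x \<in> carrier B" "y \<in> carrier B"
    "brace_lambda B a x = brace_lambda B a y"
  then have "a \<otimes> x = a \<otimes> y"
    using add.l_cancel[of "\<ominus> a" "a \<otimes> x" "a \<otimes> y"] add.inv_closed[of a] assms
    by (simp add: brace_lambda_def a_inv_def)
  then show "x = y" using xy assms by simp
qed

lemma brace_lambda_image_carrier:
  assumes "a \<in> carrier B" shows "brace_lambda B a ` carrier B = carrier B"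
proof
  show "brace_lambda B a ` carrier B \<subseteq> carrier B"
    using brace_lambda_closed assms by blast
  show "carrier B \<subseteq> brace_lambda B a ` carrier B"
  proof
    fix y assume y: "y \<in> carrier B"
    have m: "\<ominus> a \<in> carrier B"
      using add.inv_closed[of a] assms by (simp add: a_inv_def)
    have s: "a \<oplus> y \<in> carrier B" using add.m_closed[of a y] assms y by simp
    define x where "x = inv a \<otimes> (a \<oplus> y)"
    have x: "x \<in> carrier B" using assms s by (simp add: x_def)
    have "a \<otimes> x = a \<oplus> y"
      using assms s by (simp add: x_def mult.m_assoc[symmetric])
    then have "brace_lambda B a x = (\<ominus> a \<oplus> a) \<oplus> y"
      using add.m_assoc[of "\<ominus> a" a y] assms y m by (simp add: brace_lambda_def)
    also have "\<dots> = y"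
      using add.l_inv[of a] add.l_one[of y] assms y by (simp add: a_inv_def)
    finally show "y \<in> brace_lambda B a ` carrier B" using x by blast
  qed
qed

lemma brace_ideal_carrier: "brace_ideal B (carrier B)"
proof -
  have "carrier B \<lhd> B"
    by (simp add: mult.normal_inv_iff mult.subgroup_self)
  moreover have "carrier B \<lhd> add_monoid B"
    using add.normal_inv_iff[of "carrier B"] add.subgroup_self add.m_closed add.inv_closed
    by simp
  ultimately show ?thesis
    using brace_lambda_image_carrier add.subgroup_self
    by (simp add: brace_ideal_def brace_left_ideal_def)
qed

lemma brace_ideal_Inter:
  assumes ne: "\<I> \<noteq> {}" and ideals: "\<And>I. I \<in> \<I> \<Longrightarrow> brace_ideal B I"
  shows "brace_ideal B (\<Inter>\<I>)"
proof -
  have 1: "subgroup (\<Inter>\<I>) (add_monoid B)"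
    using add.subgroups_Inter[OF _ ne] ideals
    by (simp add: brace_ideal_def brace_left_ideal_def)
  have 2: "subgroup (\<Inter>\<I>) B"
    using mult.subgroups_Inter[OF _ ne] ideals normal_imp_subgroup
    by (simp add: brace_ideal_def normal_imp_subgroup)
  have 3: "\<Inter>\<I> \<lhd> add_monoid B"
    unfolding add.normal_inv_iff using 1 ideals
    by (auto simp: brace_ideal_def add.normal_inv_iff)
  have 4: "\<Inter>\<I> \<lhd> B"
    unfolding mult.normal_inv_iff using 2 ideals
    by (auto simp: brace_ideal_def mult.normal_inv_iff)
  have 5: "brace_lambda B b ` \<Inter>\<I> = \<Inter>\<I>" if b: "b \<in> carrier B" for b
  proof -
    have sub: "I \<subseteq> carrier B" if "I \<in> \<I>" for I
      using ideals[OF that] subgroup.subset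
      by (fastforce simp: brace_ideal_def brace_left_ideal_def)
    obtain I0 where "I0 \<in> \<I>" using ne by blast
    then have "brace_lambda B b ` (\<Inter>I\<in>\<I>. I) = (\<Inter>I\<in>\<I>. brace_lambda B b ` I)"
      using image_INT[OF inj_on_brace_lambda[OF b], of \<I> "\<lambda>I. I" I0] sub by auto
    also have "\<dots> = (\<Inter>I\<in>\<I>. I)"
      using ideals b by (intro INF_cong) (auto simp: brace_ideal_def brace_left_ideal_def)
    finally show ?thesis by simp
  qed
  show ?thesis using 1 3 4 5 by (simp add: brace_ideal_def brace_left_ideal_def)
qed

lemma brace_ideal_generated_ideal:
  assumes "S \<subseteq> carrier B" shows "brace_ideal B (brace_ideal_generated B S)"
  unfolding brace_ideal_generated_def
  by (rule brace_ideal_Inter) (use assms brace_ideal_carrier in auto)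

end

end

theory Submission
  imports Defs
begin

text \<open>
  In a two-sided skew brace the multiplicative inner automorphisms are additive, so
  characteristic subgroups of the additive group, in particular its derived subgroups, are ideals.

  If the additive group is solvable, it therefore suffices to descend from an ideal \<open>I\<close> to a
  smaller ideal \<open>J\<close> with \<open>I/J\<close> additively abelian. Such a quotient is a finite radical ring under
  \<open>x * y = \<lambda>\<^sub>x(y) - y\<close>; its square is invariant under everything in \<open>B\<close> and, by a Nakayama argument,
  proper. Its preimage is an ideal that contains \<open>[I, I]\<^sub>B\<close>.

  If the multiplicative group is solvable, let \<open>N\<close> and \<open>N'\<close> be the additive subgroups generated by
  the elements \<open>-a + ab - b\<close> and \<open>-b + ab - a\<close>. They are normal, and \<open>x \<mapsto> x\<close> and \<open>x \<mapsto> -x\<close> induce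
  homomorphisms from the multiplicative group onto the additive groups modulo \<open>N\<close> and \<open>N'\<close>, so some
  additive derived subgroup lies in \<open>N \<inter> N'\<close>. Expanding \<open>(a + b)(c + d)\<close> in two ways shows
  that \<open>N\<close> and \<open>N'\<close> centralize each other; hence \<open>N \<inter> N'\<close> is additively abelian.
\<close>

section \<open>Generated subgroups\<close>

lemma (in group_hom) image_generate_subset:
  assumes "S \<subseteq> carrier G" "subgroup K H" "h ` S \<subseteq> K"
  shows "h ` generate G S \<subseteq> K"
  using generate_img[OF assms(1)] H.generate_subgroup_incl[OF assms(3,2)] by simp

text \<open>The centralizer of \<open>y\<close> is a subgroup.\<close>

lemma (in group) generate_commute:
  assumes S: "S \<subseteq> carrier G" and y: "y \<in> carrier G"
    and comm: "\<And>s. s \<in> S \<Longrightarrow> s \<otimes> y = y \<otimes> s"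
    and x: "x \<in> generate G S"
  shows "x \<otimes> y = y \<otimes> x"
  using x
proof (induction rule: generate.induct)
  case (inv s)
  then have "s \<in> carrier G" "y = inv s \<otimes> y \<otimes> s"
    using S y comm[of s] by (auto simp: m_assoc inv_solve_left)
  then show ?case using y by (metis inv_closed inv_solve_right m_closed)
next
  case (eng u v)
  then have "u \<in> carrier G" "v \<in> carrier G" using generate_in_carrier[OF S] by auto
  with eng show ?case using y by (metis m_assoc)
qed (use y comm in auto)

subsection \<open>Skew braces\<close>

context skew_brace
begin

section \<open>Arithmetic in the additive group\<close>

lemma add_closed [simp]: "\<lbrakk> a \<in> carrier B; b \<in> carrier B \<rbrakk> \<Longrightarrow> a \<oplus> b \<in> carrier B"
  using add.m_closed by simp

lemma neg_closed [simp]: "a \<in> carrier B \<Longrightarrow> \<ominus> a \<in> carrier B"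
  using add.inv_closed by (simp add: a_inv_def)

lemma zero_closed [simp]: "\<zero> \<in> carrier B"
  using add.one_closed by simp

lemma mult_zero [simp]: "a \<in> carrier B \<Longrightarrow> a \<otimes> \<zero> = a" "a \<in> carrier B \<Longrightarrow> \<zero> \<otimes> a = a"
  using mult.r_one[of a] mult.l_one[of a] by (simp_all only: one_eq_zero)

lemma add_assoc:
  "\<lbrakk> a \<in> carrier B; b \<in> carrier B; c \<in> carrier B \<rbrakk> \<Longrightarrow> a \<oplus> b \<oplus> c = a \<oplus> (b \<oplus> c)"
  using add.m_assoc by simp

lemma add_zero [simp]: "a \<in> carrier B \<Longrightarrow> \<zero> \<oplus> a = a" "a \<in> carrier B \<Longrightarrow> a \<oplus> \<zero> = a"
  using add.l_one add.r_one by simp_all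

lemma add_neg [simp]: "a \<in> carrier B \<Longrightarrow> \<ominus> a \<oplus> a = \<zero>" "a \<in> carrier B \<Longrightarrow> a \<oplus> \<ominus> a = \<zero>"
  using add.l_inv add.r_inv by (simp_all add: a_inv_def)

lemma add_neg_cancel:
  assumes "a \<in> carrier B" "b \<in> carrier B"
  shows "\<ominus> a \<oplus> (a \<oplus> b) = b" "a \<oplus> (\<ominus> a \<oplus> b) = b"
  using assms by (simp_all flip: add_assoc)

lemma neg_neg [simp]: "a \<in> carrier B \<Longrightarrow> \<ominus> (\<ominus> a) = a"
  using add.inv_inv by (simp add: a_inv_def)

lemma neg_zero [simp]: "\<ominus> \<zero> = \<zero>"
  using add.inv_one by (simp add: a_inv_def)

lemma neg_add: "\<lbrakk> a \<in> carrier B; b \<in> carrier B \<rbrakk> \<Longrightarrow> \<ominus> (a \<oplus> b) = \<ominus> b \<oplus> \<ominus> a"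
  using add.inv_mult_group[of a b] by (simp add: a_inv_def)

lemmas add_group_simps = add_assoc add_neg_cancel neg_add a_minus_def

lemma mult_inv_cancel:
  assumes "a \<in> carrier B" "b \<in> carrier B"
  shows "inv a \<otimes> (a \<otimes> b) = b" "a \<otimes> (inv a \<otimes> b) = b"
  using assms by (simp_all flip: mult.m_assoc)

lemma add_left_cancel:
  "\<lbrakk> a \<in> carrier B; b \<in> carrier B; c \<in> carrier B \<rbrakk> \<Longrightarrow> a \<oplus> b = a \<oplus> c \<longleftrightarrow> b = c"
  using add.l_cancel[of a b c] by auto

lemma add_right_cancel:
  "\<lbrakk> a \<in> carrier B; b \<in> carrier B; c \<in> carrier B \<rbrakk> \<Longrightarrow> b \<oplus> a = c \<oplus> a \<longleftrightarrow> b = c"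
  using add.r_cancel[of b a c] by auto

lemma add_subgroup_iff:
  "subgroup H (add_monoid B) \<longleftrightarrow>
    H \<subseteq> carrier B \<and> \<zero> \<in> H \<and> (\<forall>x\<in>H. \<forall>y\<in>H. x \<oplus> y \<in> H) \<and> (\<forall>x\<in>H. \<ominus> x \<in> H)"
  by (auto simp: subgroup_def a_inv_def)

lemma add_normal_iff:
  "H \<lhd> add_monoid B \<longleftrightarrow>
    subgroup H (add_monoid B) \<and> (\<forall>x\<in>carrier B. \<forall>h\<in>H. x \<oplus> h \<oplus> \<ominus> x \<in> H)"
  by (simp add: add.normal_inv_iff a_inv_def)

section \<open>The action of the multiplicative group on the additive group\<close>

abbreviation lam :: "'a \<Rightarrow> 'a \<Rightarrow> 'a" where "lam \<equiv> brace_lambda B"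

lemma mult_eq_add_lambda: "\<lbrakk> a \<in> carrier B; b \<in> carrier B \<rbrakk> \<Longrightarrow> a \<otimes> b = a \<oplus> lam a b"
  by (simp add: brace_lambda_def add_group_simps)

lemma lambda_add:
  "\<lbrakk> a \<in> carrier B; b \<in> carrier B; c \<in> carrier B \<rbrakk> \<Longrightarrow> lam a (b \<oplus> c) = lam a b \<oplus> lam a c"
  by (simp add: brace_lambda_def brace_left_distrib add_group_simps)

lemma lambda_zero [simp]: "a \<in> carrier B \<Longrightarrow> lam a \<zero> = \<zero>"
  by (simp add: brace_lambda_def)

lemma lambda_neg: "\<lbrakk> a \<in> carrier B; b \<in> carrier B \<rbrakk> \<Longrightarrow> lam a (\<ominus> b) = \<ominus> lam a b"
  using lambda_add[of a b "\<ominus> b"] add_left_cancel[of "lam a b" "lam a (\<ominus> b)" "\<ominus> lam a b"]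
  by (simp add: brace_lambda_closed)

text \<open>Both bracketings of the triple product are expanded by
  \<open>mult_eq_add_lambda\<close>; the common summands \<open>a\<close> and \<open>lam a b\<close>
  then cancel on the left.\<close>

lemma lambda_mult:
  assumes "a \<in> carrier B" "b \<in> carrier B" "c \<in> carrier B"
  shows "lam (a \<otimes> b) c = lam a (lam b c)"
proof -
  have "a \<oplus> (lam a b \<oplus> lam (a \<otimes> b) c) = a \<oplus> (lam a b \<oplus> lam a (lam b c))"
    using mult.m_assoc[OF assms] assms
    by (simp add: mult_eq_add_lambda lambda_add brace_lambda_closed add_assoc)
  then show ?thesis
    using assms by (simp add: add_left_cancel brace_lambda_closed)
qed

lemma lambda_one: "b \<in> carrier B \<Longrightarrow> lam \<one> b = b"
  by (simp add: brace_lambda_def one_eq_zero)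

lemma lambda_group_hom: "a \<in> carrier B \<Longrightarrow> group_hom (add_monoid B) (add_monoid B) (lam a)"
  by (simp add: group_hom_def group_hom_axioms_def add.is_group hom_def
      brace_lambda_closed lambda_add)

lemma add_conj_group_hom:
  "b \<in> carrier B \<Longrightarrow> group_hom (add_monoid B) (add_monoid B) (\<lambda>x. b \<oplus> x \<oplus> \<ominus> b)"
  by (auto simp: group_hom_def group_hom_axioms_def add.is_group hom_def add_group_simps)

section \<open>Ideals\<close>

lemma left_ideal_mult_subgroup:
  assumes I: "subgroup I (add_monoid B)"
    and lam: "\<And>b x. \<lbrakk> b \<in> carrier B; x \<in> I \<rbrakk> \<Longrightarrow> lam b x \<in> I"
  shows "subgroup I B"
proof (rule mult.subgroupI)
  show sub: "I \<subseteq> carrier B" and "I \<noteq> {}"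
    using I by (auto simp: add_subgroup_iff)
  fix a assume a: "a \<in> I"
  then have ac: "a \<in> carrier B" using sub by blast
  \<comment> \<open>This is \<open>inv a \<otimes> a = \<one>\<close> rewritten with
    \<open>lam\<close>; it exhibits the multiplicative inverse as the additive inverse of an element
    of \<open>I\<close>.\<close>
  have "inv a \<oplus> lam (inv a) a = \<zero>"
    using mult_eq_add_lambda[of "inv a" a] ac by (simp add: one_eq_zero)
  then have "inv a = \<ominus> lam (inv a) a"
    using ac add_right_cancel[of "lam (inv a) a" "inv a" "\<ominus> lam (inv a) a"]
    by (simp add: brace_lambda_closed)
  then show "inv a \<in> I"
    using I lam[of "inv a" a] a ac by (auto simp: add_subgroup_iff)
  fix b assume "b \<in> I"
  then show "a \<otimes> b \<in> I"
    using I lam[of a b] a ac sub by (simp add: mult_eq_add_lambda add_subgroup_iff subsetD)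
qed

text \<open>Inclusions suffice: \<open>lam (inv b)\<close> inverts \<open>lam b\<close>, which
  upgrades stability to equality, and the multiplicative subgroup property comes from
  \<open>left_ideal_mult_subgroup\<close>.\<close>

lemma brace_idealI:
  assumes I: "subgroup I (add_monoid B)"
    and lam: "\<And>b x. \<lbrakk> b \<in> carrier B; x \<in> I \<rbrakk> \<Longrightarrow> lam b x \<in> I"
    and add: "\<And>b x. \<lbrakk> b \<in> carrier B; x \<in> I \<rbrakk> \<Longrightarrow> b \<oplus> x \<oplus> \<ominus> b \<in> I"
    and mult: "\<And>b x. \<lbrakk> b \<in> carrier B; x \<in> I \<rbrakk> \<Longrightarrow> b \<otimes> x \<otimes> inv b \<in> I"
  shows "brace_ideal B I"
proof -
  have sub: "I \<subseteq> carrier B" using I by (auto simp: add_subgroup_iff)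
  have "lam b ` I = I" if b: "b \<in> carrier B" for b
  proof
    show "lam b ` I \<subseteq> I" using lam b by blast
    show "I \<subseteq> lam b ` I"
    proof
      fix x assume x: "x \<in> I"
      then have "x = lam b (lam (inv b) x)"
        using b sub lambda_mult[of b "inv b" x] by (auto simp: lambda_one)
      then show "x \<in> lam b ` I" using lam[of "inv b" x] b x by simp
    qed
  qed
  then show ?thesis
    using I add mult left_ideal_mult_subgroup[OF I lam]
    by (simp add: brace_ideal_def brace_left_ideal_def add_normal_iff mult.normal_inv_iff)
qed

lemma brace_idealD:
  assumes "brace_ideal B I"
  shows "subgroup I (add_monoid B)" "subgroup I B" "I \<subseteq> carrier B"
    and "\<And>b x. \<lbrakk> b \<in> carrier B; x \<in> I \<rbrakk> \<Longrightarrow> lam b x \<in> I"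
    and "\<And>b x. \<lbrakk> b \<in> carrier B; x \<in> I \<rbrakk> \<Longrightarrow> b \<oplus> x \<oplus> \<ominus> b \<in> I"
    and "\<And>b x. \<lbrakk> b \<in> carrier B; x \<in> I \<rbrakk> \<Longrightarrow> b \<otimes> x \<otimes> inv b \<in> I"
  using assms
  by (fastforce simp: brace_ideal_def brace_left_ideal_def add_normal_iff mult.normal_inv_iff
      add_subgroup_iff)+

section \<open>Derived series of the skew brace and of its two groups\<close>

lemma commutator_subset_brace_commutator:
  "derived (add_monoid B) I \<subseteq> brace_commutator B I I" "derived B I \<subseteq> brace_commutator B I I"
  by (auto simp: brace_commutator_def brace_ideal_generated_def commutator_subgroup_self)

lemma brace_derived_series_ideal: "brace_ideal B (brace_derived_series B n)"
proof (induction n)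
  case (Suc n)
  note c = brace_idealD(3)[OF Suc]
  have "derived (add_monoid B) (brace_derived_series B n) \<subseteq> carrier B"
    "derived B (brace_derived_series B n) \<subseteq> carrier B"
    using add.derived_in_carrier[of "brace_derived_series B n"]
      mult.derived_in_carrier[of "brace_derived_series B n"] c by simp_all
  then show ?case
    unfolding brace_derived_series.simps brace_commutator_def commutator_subgroup_self
    by (intro brace_ideal_generated_ideal) (use c in \<open>auto simp: a_minus_def subset_iff\<close>)
qed (simp add: brace_ideal_carrier)

text \<open>By monotonicity of \<open>derived\<close>, the \<open>k\<close>-th derived subgroups of
  both groups lie in the \<open>k\<close>-th term of the brace series.\<close>

lemma brace_solvable_imp_solvable:
  assumes "brace_solvable B"
  shows "solvable (add_monoid B)" "solvable B"
proof -
  obtain n where n: "brace_derived_series B n = {\<zero>}"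
    using assms by (auto simp: brace_solvable_def)
  have "(derived (add_monoid B) ^^ k) (carrier B) \<subseteq> brace_derived_series B k \<and>
    (derived B ^^ k) (carrier B) \<subseteq> brace_derived_series B k" for k
  proof (induction k)
    case (Suc k)
    then show ?case
      using commutator_subset_brace_commutator[of "brace_derived_series B k"]
        add.mono_derived[of _ "brace_derived_series B k"]
        mult.mono_derived[of _ "brace_derived_series B k"] by simp blast
  qed simp
  from this[of n] n have "(derived (add_monoid B) ^^ n) (carrier B) \<subseteq> {\<zero>}"
    "(derived B ^^ n) (carrier B) \<subseteq> {\<zero>}" by simp_all
  moreover have "\<zero> \<in> (derived (add_monoid B) ^^ n) (carrier B)" "\<zero> \<in> (derived B ^^ n) (carrier B)"
    using subgroup.one_closed[OF add.exp_of_derived_is_subgroup[OF add.subgroup_self, of n]]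
      subgroup.one_closed[OF mult.exp_of_derived_is_subgroup[OF mult.subgroup_self, of n]]
    by (simp_all add: one_eq_zero)
  ultimately have "(derived (add_monoid B) ^^ n) (carrier B) = {\<zero>}"
    "(derived B ^^ n) (carrier B) = {\<one>}" by (auto simp: one_eq_zero)
  then show "solvable (add_monoid B)" "solvable B"
    unfolding add.solvable_iff_trivial_derived_seq mult.solvable_iff_trivial_derived_seq by auto
qed

section \<open>Normal subgroups of the additive group\<close>

lemma generate_add_normal:
  assumes S: "S \<subseteq> carrier B"
    and conj: "\<And>b s. \<lbrakk> b \<in> carrier B; s \<in> S \<rbrakk> \<Longrightarrow>
      b \<oplus> s \<oplus> \<ominus> b \<in> generate (add_monoid B) S"
  shows "generate (add_monoid B) S \<lhd> add_monoid B"
proof -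
  have sg: "subgroup (generate (add_monoid B) S) (add_monoid B)"
    using add.generate_is_subgroup[of S] S by simp
  have "(\<lambda>x. b \<oplus> x \<oplus> \<ominus> b) ` generate (add_monoid B) S \<subseteq> generate (add_monoid B) S"
    if "b \<in> carrier B" for b
    using group_hom.image_generate_subset[OF add_conj_group_hom[OF that] _ sg, of S] S conj that
    by auto
  then show ?thesis using sg by (auto simp: add_normal_iff)
qed

text \<open>The map \<open>f\<close> induces a homomorphism from the multiplicative group onto the
  additive group modulo \<open>N\<close>, so that quotient has trivial \<open>n\<close>-th derived
  subgroup. It is applied to the identity and to negation.\<close>

lemma exp_of_derived_add_subset:
  assumes N: "N \<lhd> add_monoid B"
    and f: "f ` carrier B = carrier B"
    and hom: "\<And>a b. \<lbrakk> a \<in> carrier B; b \<in> carrier B \<rbrakk> \<Longrightarrow>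
      f (a \<otimes> b) \<oplus> \<ominus> (f a \<oplus> f b) \<in> N"
    and n: "(derived B ^^ n) (carrier B) = {\<one>}"
  shows "(derived (add_monoid B) ^^ n) (carrier B) \<subseteq> N"
proof
  let ?A = "add_monoid B"
  let ?\<pi> = "\<lambda>x. N #>\<^bsub>?A\<^esub> x"
  interpret N: normal N ?A by fact
  interpret Q: group "?A Mod N" by (rule N.factorgroup_is_group)
  have fc: "f a \<in> carrier B" if "a \<in> carrier B" for a using f that by blast
  have coset: "?\<pi> x = ?\<pi> y" if "x \<oplus> \<ominus> y \<in> N" "x \<in> carrier B" "y \<in> carrier B" for x y
  proof -
    have "x = (x \<oplus> \<ominus> y) \<oplus> y" using that by (simp add: add_group_simps)
    then have "x \<in> ?\<pi> y" using that by (force simp: r_coset_def)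
    then show ?thesis
      using add.repr_independence[OF _ _ N.is_subgroup, of x y] that by simp
  qed
  have \<pi>: "group_hom ?A (?A Mod N) ?\<pi>"
    using N.r_coset_hom_Mod by (simp add: group_hom_def group_hom_axioms_def add.is_group Q.is_group)
  have \<pi>f: "group_hom B (?A Mod N) (\<lambda>a. ?\<pi> (f a))"
  proof -
    have "?\<pi> (f (a \<otimes> b)) = ?\<pi> (f a) \<otimes>\<^bsub>?A Mod N\<^esub> ?\<pi> (f b)"
      if "a \<in> carrier B" "b \<in> carrier B" for a b
      using coset[OF hom[OF that]] that fc N.rcos_sum[of "f a" "f b"] by simp
    moreover have "?\<pi> (f a) \<in> carrier (?A Mod N)" if "a \<in> carrier B" for a
      using fc[OF that] by (auto simp: FactGroup_def RCOSETS_def)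
    ultimately show ?thesis
      by (simp add: group_hom_def group_hom_axioms_def mult.is_group Q.is_group hom_def)
  qed
  have img: "(\<lambda>a. ?\<pi> (f a)) ` carrier B = ?\<pi> ` carrier B"
    using f by (metis image_image)
  \<comment> \<open>Homomorphisms commute with \<open>derived\<close>, and by \<open>img\<close>
    both maps into the quotient have the same image.\<close>
  have "?\<pi> ` ((derived ?A ^^ n) (carrier B)) = (\<lambda>a. ?\<pi> (f a)) ` ((derived B ^^ n) (carrier B))"
    using group_hom.exp_of_derived_img[OF \<pi>, of "carrier B" n]
      group_hom.exp_of_derived_img[OF \<pi>f, of "carrier B" n] img by simp
  also have "\<dots> = {N}"
    using n group_hom.hom_one[OF \<pi>f] by simp
  finally have triv: "?\<pi> ` ((derived ?A ^^ n) (carrier B)) = {N}" .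
  fix x assume x: "x \<in> (derived ?A ^^ n) (carrier B)"
  then have "x \<in> carrier B" using add.exp_of_derived_in_carrier[of "carrier B" n] by auto
  moreover have "?\<pi> x = N" using triv x by blast
  ultimately show "x \<in> N" using add.coset_join1[OF _ _ N.is_subgroup] by simp
qed

section \<open>The star operation and its opposite\<close>

definition "star a b = \<ominus> a \<oplus> (a \<otimes> b) \<oplus> \<ominus> b"

text \<open>This is \<open>star\<close> for the skew brace with reversed addition.\<close>

definition "op_star a b = \<ominus> b \<oplus> (a \<otimes> b) \<oplus> \<ominus> a"

lemma star_closed: "\<lbrakk> a \<in> carrier B; b \<in> carrier B \<rbrakk> \<Longrightarrow> star a b \<in> carrier B"
  by (simp add: star_def)

lemma op_star_closed: "\<lbrakk> a \<in> carrier B; b \<in> carrier B \<rbrakk> \<Longrightarrow> op_star a b \<in> carrier B"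
  by (simp add: op_star_def)

text \<open>\<open>star_subgroup\<close> and \<open>op_star_subgroup\<close> are the
  \<open>N\<close> and \<open>N'\<close> of the overview.\<close>

definition star_subgroup :: "'a set" where
  "star_subgroup = generate (add_monoid B) {star a b | a b. a \<in> carrier B \<and> b \<in> carrier B}"

definition op_star_subgroup :: "'a set" where
  "op_star_subgroup = generate (add_monoid B) {op_star a b | a b. a \<in> carrier B \<and> b \<in> carrier B}"

text \<open>Left distributivity gives \<open>star a (b \<oplus> c) = star a b \<oplus> (b \<oplus>
  star a c \<oplus> \<ominus> b)\<close>. Conjugates of generators therefore stay in
  \<open>star_subgroup\<close>, which yields normality.\<close>

lemma star_conj:
  "\<lbrakk> a \<in> carrier B; b \<in> carrier B; c \<in> carrier B \<rbrakk> \<Longrightarrow>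
    b \<oplus> star a c \<oplus> \<ominus> b = \<ominus> star a b \<oplus> star a (b \<oplus> c)"
  by (simp add: star_def brace_left_distrib add_group_simps)

text \<open>Expanding \<open>op_star a (c \<oplus> \<ominus> b)\<close> gives the conjugate followed
  by \<open>op_star a (\<ominus> b)\<close>; the sign of \<open>b\<close> arises because
  \<open>op_star\<close> begins with the negative of its second argument.\<close>

lemma op_star_conj:
  "\<lbrakk> a \<in> carrier B; b \<in> carrier B; c \<in> carrier B \<rbrakk> \<Longrightarrow>
    b \<oplus> op_star a c \<oplus> \<ominus> b = op_star a (c \<oplus> \<ominus> b) \<oplus> \<ominus> op_star a (\<ominus> b)"
  by (simp add: op_star_def brace_left_distrib add_group_simps)

lemma star_subgroup_normal: "star_subgroup \<lhd> add_monoid B"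
  unfolding star_subgroup_def
proof (rule generate_add_normal)
  let ?S = "{star a b | a b. a \<in> carrier B \<and> b \<in> carrier B}"
  show S: "?S \<subseteq> carrier B" by (auto simp: star_closed)
  have sg: "subgroup (generate (add_monoid B) ?S) (add_monoid B)"
    using add.generate_is_subgroup[of ?S] S by simp
  fix b s assume b: "b \<in> carrier B" and "s \<in> ?S"
  then obtain a c where s: "s = star a c" "a \<in> carrier B" "c \<in> carrier B" by blast
  have "star a b \<in> generate (add_monoid B) ?S" "star a (b \<oplus> c) \<in> generate (add_monoid B) ?S"
    using s b by (auto intro!: generate.incl exI)
  then show "b \<oplus> s \<oplus> \<ominus> b \<in> generate (add_monoid B) ?S"
    using sg s b by (simp add: star_conj add_subgroup_iff)
qed

lemma op_star_subgroup_normal: "op_star_subgroup \<lhd> add_monoid B"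
  unfolding op_star_subgroup_def
proof (rule generate_add_normal)
  let ?S = "{op_star a b | a b. a \<in> carrier B \<and> b \<in> carrier B}"
  show S: "?S \<subseteq> carrier B" by (auto simp: op_star_closed)
  have sg: "subgroup (generate (add_monoid B) ?S) (add_monoid B)"
    using add.generate_is_subgroup[of ?S] S by simp
  fix b s assume b: "b \<in> carrier B" and "s \<in> ?S"
  then obtain a c where s: "s = op_star a c" "a \<in> carrier B" "c \<in> carrier B" by blast
  have "op_star a (\<ominus> b) \<in> generate (add_monoid B) ?S"
    "op_star a (c \<oplus> \<ominus> b) \<in> generate (add_monoid B) ?S"
    using s b by (auto intro!: generate.incl exI)
  then show "b \<oplus> s \<oplus> \<ominus> b \<in> generate (add_monoid B) ?S"
    using sg s b by (simp add: op_star_conj add_subgroup_iff)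
qed

end

subsection \<open>Two-sided skew braces\<close>

context two_sided_skew_brace
begin

text \<open>Left and right distributivity together leave one correction term,
  \<open>\<ominus> (c \<otimes> inv c)\<close>, which vanishes because
  \<open>\<one> = \<zero>\<close>.\<close>

lemma mult_conj_add:
  assumes a: "a \<in> carrier B" and b: "b \<in> carrier B" and c: "c \<in> carrier B"
  shows "c \<otimes> (a \<oplus> b) \<otimes> inv c = (c \<otimes> a \<otimes> inv c) \<oplus> (c \<otimes> b \<otimes> inv c)"
proof -
  let ?d = "inv c"
  have d: "?d \<in> carrier B" using c by simp
  \<comment> \<open>Right distributivity applied to \<open>x \<oplus> \<ominus> x = \<zero>\<close>,
    where \<open>\<zero> \<otimes> y = y\<close>.\<close>
  have neg: "(\<ominus> x) \<otimes> y = y \<ominus> x \<otimes> y \<oplus> y" if x: "x \<in> carrier B" and y: "y \<in> carrier B" for x y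
  proof -
    have "y = (x \<otimes> y) \<ominus> y \<oplus> (\<ominus> x) \<otimes> y"
      using brace_right_distrib[of x "\<ominus> x" y] x y by simp
    then have "y \<ominus> x \<otimes> y \<oplus> y = y \<ominus> x \<otimes> y \<oplus> ((x \<otimes> y) \<ominus> y \<oplus> (\<ominus> x) \<otimes> y)" by simp
    then show ?thesis using x y by (simp add: add_group_simps)
  qed
  have "c \<otimes> (a \<oplus> b) \<otimes> ?d = (c \<otimes> a \<oplus> (\<ominus> c \<oplus> c \<otimes> b)) \<otimes> ?d"
    using a b c by (simp add: brace_left_distrib add_group_simps)
  also have "\<dots> = c \<otimes> a \<otimes> ?d \<oplus> (\<ominus> (c \<otimes> ?d) \<oplus> c \<otimes> b \<otimes> ?d)"
    using a b c d brace_right_distrib[of "c \<otimes> a" "\<ominus> c \<oplus> c \<otimes> b" ?d]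
      brace_right_distrib[of "\<ominus> c" "c \<otimes> b" ?d]
    by (simp add: neg add_group_simps del: mult.r_inv)
  also have "\<dots> = c \<otimes> a \<otimes> ?d \<oplus> c \<otimes> b \<otimes> ?d"
    using a b c by (simp add: one_eq_zero)
  finally show ?thesis .
qed

lemma mult_conj_group_hom:
  "c \<in> carrier B \<Longrightarrow> group_hom (add_monoid B) (add_monoid B) (\<lambda>x. c \<otimes> x \<otimes> inv c)"
  by (simp add: group_hom_def group_hom_axioms_def add.is_group hom_def mult_conj_add)

lemma mult_conj_image_carrier:
  assumes c: "c \<in> carrier B"
  shows "(\<lambda>x. c \<otimes> x \<otimes> inv c) ` carrier B = carrier B"
proof
  show "(\<lambda>x. c \<otimes> x \<otimes> inv c) ` carrier B \<subseteq> carrier B" using c by auto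
  have "x = c \<otimes> (inv c \<otimes> x \<otimes> c) \<otimes> inv c" if "x \<in> carrier B" for x
    using that c by (simp add: mult.m_assoc mult_inv_cancel)
  then show "carrier B \<subseteq> (\<lambda>x. c \<otimes> x \<otimes> inv c) ` carrier B"
    using c by (auto intro!: image_eqI)
qed

text \<open>Conjugation by \<open>c\<close> respects both operations, hence also \<open>lam\<close>,
  which is built from them.\<close>

lemma lambda_mult_conj:
  assumes a: "a \<in> carrier B" and b: "b \<in> carrier B" and c: "c \<in> carrier B"
  shows "c \<otimes> lam a b \<otimes> inv c = lam (c \<otimes> a \<otimes> inv c) (c \<otimes> b \<otimes> inv c)"
proof -
  let ?f = "\<lambda>x. c \<otimes> x \<otimes> inv c"
  have "?f a \<oplus> ?f (lam a b) = ?f (a \<otimes> b)"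
    using assms by (simp add: mult_eq_add_lambda[of a b] mult_conj_add brace_lambda_closed)
  also have "\<dots> = ?f a \<otimes> ?f b"
    using assms by (simp add: mult.m_assoc mult_inv_cancel)
  finally have "?f a \<oplus> ?f (lam a b) = ?f a \<oplus> lam (?f a) (?f b)"
    using assms by (simp add: mult_eq_add_lambda[of "?f a" "?f b"])
  then show ?thesis
    using assms by (simp add: add_left_cancel brace_lambda_closed)
qed

lemma exp_of_derived_ideal: "brace_ideal B ((derived (add_monoid B) ^^ n) (carrier B))"
  (is "brace_ideal B ?D")
proof (rule brace_idealI)
  \<comment> \<open>Surjective additive endomorphisms map each derived subgroup of the carrier onto
    itself; \<open>lam b\<close> and both conjugations by \<open>b\<close> are of this kind.\<close>
  have inv: "f x \<in> ?D" if "group_hom (add_monoid B) (add_monoid B) f"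
    "f ` carrier B = carrier B" "x \<in> ?D" for f x
    using group_hom.exp_of_derived_img[OF that(1), of "carrier B" n] that(2,3) by auto
  show "subgroup ?D (add_monoid B)"
    using add.exp_of_derived_is_subgroup[OF add.subgroup_self, of n] by simp
  fix b x assume b: "b \<in> carrier B" and x: "x \<in> ?D"
  show "lam b x \<in> ?D"
    using inv[OF lambda_group_hom brace_lambda_image_carrier] b x by blast
  show "b \<otimes> x \<otimes> inv b \<in> ?D"
    using inv[OF mult_conj_group_hom mult_conj_image_carrier] b x by blast
  have "x = b \<oplus> (\<ominus> b \<oplus> x \<oplus> b) \<oplus> \<ominus> b" if "x \<in> carrier B" for x
    using that b by (simp add: add_group_simps)
  then have "(\<lambda>x. b \<oplus> x \<oplus> \<ominus> b) ` carrier B = carrier B"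
    using b by (auto intro!: image_eqI)
  then show "b \<oplus> x \<oplus> \<ominus> b \<in> ?D" using inv[OF add_conj_group_hom] b x by blast
qed

section \<open>From the multiplicative to the additive group\<close>

lemma star_op_star_commute:
  assumes a: "a \<in> carrier B" and b: "b \<in> carrier B" and c: "c \<in> carrier B" and d: "d \<in> carrier B"
  shows "op_star b c \<oplus> star a d = star a d \<oplus> op_star b c"
proof -
  \<comment> \<open>The two expansions share the outer terms \<open>a \<otimes> c\<close> and
    \<open>b \<otimes> d\<close>; only the order of the two middle terms differs.\<close>
  have "a \<otimes> c \<oplus> (op_star b c \<oplus> star a d \<oplus> b \<otimes> d) = (a \<oplus> b) \<otimes> c \<ominus> (a \<oplus> b) \<oplus> (a \<oplus> b) \<otimes> d"
    using assms by (simp add: brace_right_distrib op_star_def star_def add_group_simps)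
  also have "\<dots> = (a \<oplus> b) \<otimes> (c \<oplus> d)"
    using assms by (simp add: brace_left_distrib)
  also have "\<dots> = a \<otimes> (c \<oplus> d) \<ominus> (c \<oplus> d) \<oplus> b \<otimes> (c \<oplus> d)"
    using assms by (simp add: brace_right_distrib)
  also have "\<dots> = a \<otimes> c \<oplus> (star a d \<oplus> op_star b c \<oplus> b \<otimes> d)"
    using assms by (simp add: brace_left_distrib op_star_def star_def add_group_simps)
  finally show ?thesis
    using assms by (simp add: add_left_cancel add_right_cancel star_closed op_star_closed)
qed

lemma star_subgroups_commute:
  assumes x: "x \<in> op_star_subgroup" and y: "y \<in> star_subgroup"
  shows "x \<oplus> y = y \<oplus> x"
proof -
  let ?S = "{star a b | a b. a \<in> carrier B \<and> b \<in> carrier B}"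
  let ?T = "{op_star a b | a b. a \<in> carrier B \<and> b \<in> carrier B}"
  have S: "?S \<subseteq> carrier B" and T: "?T \<subseteq> carrier B"
    by (auto simp: star_closed op_star_closed)
  have xc: "x \<in> carrier B"
    using x T add.generate_in_carrier[of ?T x] by (simp add: op_star_subgroup_def)
  \<comment> \<open>First \<open>x\<close> varies against a fixed generator of
    \<open>star_subgroup\<close>; afterwards \<open>y\<close> varies against a fixed
    \<open>x\<close>.\<close>
  have "s \<oplus> x = x \<oplus> s" if s: "s \<in> ?S" for s
    using add.generate_commute[of ?T s x] x T S s
    by (fastforce simp: op_star_subgroup_def star_op_star_commute)
  then show ?thesis
    using add.generate_commute[of ?S x y] y S xc by (simp add: star_subgroup_def)
qed

lemma solvable_mult_imp_solvable_add:
  assumes "solvable B"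
  shows "solvable (add_monoid B)"
proof -
  let ?A = "add_monoid B"
  obtain n where n: "(derived B ^^ n) (carrier B) = {\<one>}"
    using assms mult.solvable_iff_trivial_derived_seq by blast
  let ?D = "(derived ?A ^^ n) (carrier B)"
  have star: "star a b \<in> star_subgroup" "op_star a b \<in> op_star_subgroup"
    if "a \<in> carrier B" "b \<in> carrier B" for a b
    using that by (auto simp: star_subgroup_def op_star_subgroup_def intro!: generate.incl)
  have "?D \<subseteq> star_subgroup"
  proof (rule exp_of_derived_add_subset[where f = "\<lambda>x. x", OF star_subgroup_normal _ _ n])
    fix a b assume ab: "a \<in> carrier B" "b \<in> carrier B"
    then have "a \<otimes> b \<oplus> \<ominus> (a \<oplus> b) = a \<oplus> star a b \<oplus> \<ominus> a"
      by (simp add: star_def add_group_simps)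
    then show "a \<otimes> b \<oplus> \<ominus> (a \<oplus> b) \<in> star_subgroup"
      using star_subgroup_normal star(1) ab by (simp add: add_normal_iff)
  qed simp
  moreover have "?D \<subseteq> op_star_subgroup"
  proof (rule exp_of_derived_add_subset[where f = "\<lambda>x. \<ominus> x", OF op_star_subgroup_normal _ _ n])
    have "x \<in> (\<lambda>x. \<ominus> x) ` carrier B" if "x \<in> carrier B" for x
      using that by (intro image_eqI[of _ _ "\<ominus> x"]) simp_all
    then show "(\<lambda>x. \<ominus> x) ` carrier B = carrier B" by auto
    fix a b assume ab: "a \<in> carrier B" "b \<in> carrier B"
    \<comment> \<open>The failure of negation to be a homomorphism is a conjugate of an inverted
      generator of \<open>op_star_subgroup\<close>.\<close>
    then have "\<ominus> (a \<otimes> b) \<oplus> \<ominus> (\<ominus> a \<oplus> \<ominus> b) = \<ominus> a \<oplus> \<ominus> op_star a b \<oplus> \<ominus> (\<ominus> a)"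
      by (simp add: op_star_def add_group_simps)
    then show "\<ominus> (a \<otimes> b) \<oplus> \<ominus> (\<ominus> a \<oplus> \<ominus> b) \<in> op_star_subgroup"
      using op_star_subgroup_normal star(2) ab
      by (simp add: add_normal_iff add_subgroup_iff del: neg_neg)
  qed
  \<comment> \<open>\<open>?D\<close> lies in both subgroups, so its elements commute pairwise; one
    more derived step, \<open>Suc n\<close>, then reaches zero.\<close>
  ultimately have comm: "x \<oplus> y = y \<oplus> x" if "x \<in> ?D" "y \<in> ?D" for x y
    using star_subgroups_commute that by blast
  have D: "subgroup ?D ?A"
    using add.exp_of_derived_is_subgroup[OF add.subgroup_self, of n] by simp
  then have Dc: "?D \<subseteq> carrier B" by (simp add: add_subgroup_iff)
  have "x \<oplus> y \<oplus> \<ominus> x \<oplus> \<ominus> y = \<zero>" if "x \<in> ?D" "y \<in> ?D" for x y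
    using comm[OF that] that Dc by (auto simp: add_group_simps subset_iff)
  then have "derived ?A ?D \<subseteq> {\<zero>}"
    using add.generate_subgroup_incl[of _ "{\<zero>}"] add.triv_subgroup
    by (auto simp: derived_def a_inv_def)
  moreover have "\<zero> \<in> derived ?A ?D"
    using add.derived_is_subgroup[of ?D] Dc by (simp add: add_subgroup_iff)
  ultimately have "(derived ?A ^^ Suc n) (carrier B) = {\<zero>}" by auto
  then show ?thesis
    unfolding add.solvable_iff_trivial_derived_seq by (intro exI[of _ "Suc n"]) simp
qed

subsection \<open>Squares of ideals\<close>

text \<open>For additively abelian \<open>I/J\<close> this is the preimage of the square of the
  radical ring \<open>I/J\<close>. Adjoining \<open>J\<close> to the generators
  \<open>star x y\<close> allows computing in \<open>B\<close> modulo \<open>J\<close> without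
  forming the quotient.\<close>

definition ideal_square :: "'a set \<Rightarrow> 'a set \<Rightarrow> 'a set" where
  "ideal_square I J =
    generate (add_monoid B) (J \<union> {lam x y \<oplus> \<ominus> y | x y. x \<in> I \<and> y \<in> I})"

context
  fixes I J
  assumes I: "brace_ideal B I" and J: "brace_ideal B J" and JI: "J \<subseteq> I"
    and IJ: "derived (add_monoid B) I \<subseteq> J"
begin

lemma ideal_closed:
  shows "x \<in> I \<Longrightarrow> x \<in> carrier B" "\<lbrakk> x \<in> I; y \<in> I \<rbrakk> \<Longrightarrow> x \<oplus> y \<in> I" "x \<in> I \<Longrightarrow> \<ominus> x \<in> I" "\<zero> \<in> I"
    "\<lbrakk> b \<in> carrier B; x \<in> I \<rbrakk> \<Longrightarrow> lam b x \<in> I" "\<lbrakk> x \<in> I; y \<in> I \<rbrakk> \<Longrightarrow> x \<otimes> y \<in> I"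
  using brace_idealD[OF I] by (auto simp: add_subgroup_iff dest: subgroup.m_closed)

lemma commutator_mem: "\<lbrakk> x \<in> I; y \<in> I \<rbrakk> \<Longrightarrow> x \<oplus> y \<oplus> \<ominus> x \<oplus> \<ominus> y \<in> J"
  using IJ by (force simp: derived_def a_inv_def intro: generate.incl)

text \<open>Assumption \<open>IJ\<close> makes \<open>I/J\<close> additively abelian. The correction
  \<open>j\<close> is kept explicit so that subgroups containing \<open>J\<close> can absorb
  it.\<close>

lemma commute_mod:
  assumes "x \<in> I" "y \<in> I"
  obtains j where "j \<in> J" "x \<oplus> y = j \<oplus> y \<oplus> x"
proof
  show "x \<oplus> y \<oplus> \<ominus> x \<oplus> \<ominus> y \<in> J" using commutator_mem assms .
  show "x \<oplus> y = x \<oplus> y \<oplus> \<ominus> x \<oplus> \<ominus> y \<oplus> y \<oplus> x"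
    using assms by (simp add: ideal_closed add_group_simps)
qed

lemma ideal_square_generators: "J \<union> {lam x y \<oplus> \<ominus> y | x y. x \<in> I \<and> y \<in> I} \<subseteq> I"
  using JI ideal_closed by auto

lemma ideal_square_subgroup: "subgroup (ideal_square I J) (add_monoid B)"
  unfolding ideal_square_def
  using order_trans[OF ideal_square_generators brace_idealD(3)[OF I]]
  by (intro add.generate_is_subgroup) simp

lemma ideal_square_incl:
  "x \<in> J \<Longrightarrow> x \<in> ideal_square I J" "\<lbrakk> x \<in> I; y \<in> I \<rbrakk> \<Longrightarrow> lam x y \<oplus> \<ominus> y \<in> ideal_square I J"
  unfolding ideal_square_def by (auto intro: generate.incl)

lemma ideal_square_minimal:
  assumes "subgroup M (add_monoid B)" "J \<subseteq> M"
    and "\<And>x y. \<lbrakk> x \<in> I; y \<in> I \<rbrakk> \<Longrightarrow> lam x y \<oplus> \<ominus> y \<in> M"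
  shows "ideal_square I J \<subseteq> M"
  unfolding ideal_square_def using assms by (intro add.generate_subgroup_incl) auto

lemma ideal_square_image:
  assumes f: "group_hom (add_monoid B) (add_monoid B) f"
    and fJ: "\<And>x. x \<in> J \<Longrightarrow> f x \<in> ideal_square I J"
    and fI: "\<And>x y. \<lbrakk> x \<in> I; y \<in> I \<rbrakk> \<Longrightarrow> f (lam x y \<oplus> \<ominus> y) \<in> ideal_square I J"
    and x: "x \<in> ideal_square I J"
  shows "f x \<in> ideal_square I J"
proof -
  have "f ` ideal_square I J \<subseteq> ideal_square I J"
    unfolding ideal_square_def
  proof (rule group_hom.image_generate_subset[OF f])
    show "J \<union> {lam x y \<oplus> \<ominus> y | x y. x \<in> I \<and> y \<in> I} \<subseteq> carrier (add_monoid B)"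
      using order_trans[OF ideal_square_generators brace_idealD(3)[OF I]] by simp
  qed (use ideal_square_subgroup fJ fI in \<open>auto simp flip: ideal_square_def\<close>)
  then show ?thesis using x by blast
qed

lemma ideal_square_ideal: "brace_ideal B (ideal_square I J)"
proof (rule brace_idealI[OF ideal_square_subgroup])
  fix b z assume b: "b \<in> carrier B" and z: "z \<in> ideal_square I J"
  let ?c = "\<lambda>x. b \<otimes> x \<otimes> inv b"
  have cI: "?c x \<in> I" if "x \<in> I" for x using brace_idealD(6)[OF I b that] .
  show "lam b z \<in> ideal_square I J"
  proof (rule ideal_square_image[OF lambda_group_hom[OF b] _ _ z])
    show "lam b x \<in> ideal_square I J" if "x \<in> J" for x
      using ideal_square_incl(1) brace_idealD(4)[OF J b that] .
    fix x y assume xy: "x \<in> I" "y \<in> I"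
    \<comment> \<open>Since \<open>b \<otimes> x = ?c x \<otimes> b\<close>, the map
      \<open>lam b\<close> passes through \<open>lam x\<close> and sends generators to
      generators.\<close>
    have "lam b (lam x y) = lam (?c x \<otimes> b) y"
      using xy b ideal_closed(1) by (simp add: lambda_mult[symmetric] mult.m_assoc)
    then have "lam b (lam x y \<oplus> \<ominus> y) = lam (?c x) (lam b y) \<oplus> \<ominus> lam b y"
      using xy b by (simp add: lambda_add lambda_neg lambda_mult brace_lambda_closed ideal_closed)
    then show "lam b (lam x y \<oplus> \<ominus> y) \<in> ideal_square I J"
      using ideal_square_incl(2)[OF cI[OF xy(1)] ideal_closed(5)[OF b xy(2)]] by simp
  qed
  show "?c z \<in> ideal_square I J"
  proof (rule ideal_square_image[OF mult_conj_group_hom[OF b] _ _ z])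
    show "?c x \<in> ideal_square I J" if "x \<in> J" for x
      using ideal_square_incl(1) brace_idealD(6)[OF J b that] .
    fix x y assume xy: "x \<in> I" "y \<in> I"
    have "?c y \<oplus> ?c (\<ominus> y) = ?c (y \<oplus> \<ominus> y)"
      using xy b ideal_closed by (subst mult_conj_add) auto
    also have "\<dots> = \<zero>" using xy b by (simp add: ideal_closed one_eq_zero)
    finally have "?c (\<ominus> y) = \<ominus> ?c y"
      using xy b ideal_closed add_left_cancel[of "?c y" "?c (\<ominus> y)" "\<ominus> ?c y"] by simp
    then have "?c (lam x y \<oplus> \<ominus> y) = lam (?c x) (?c y) \<oplus> \<ominus> ?c y"
      using xy b ideal_closed(1) by (simp add: mult_conj_add lambda_mult_conj brace_lambda_closed)
    then show "?c (lam x y \<oplus> \<ominus> y) \<in> ideal_square I J"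
      using ideal_square_incl(2)[OF cI cI] xy by simp
  qed
  show "b \<oplus> z \<oplus> \<ominus> b \<in> ideal_square I J"
  proof (rule ideal_square_image[OF add_conj_group_hom[OF b] _ _ z])
    show "b \<oplus> x \<oplus> \<ominus> b \<in> ideal_square I J" if "x \<in> J" for x
      using ideal_square_incl(1) brace_idealD(5)[OF J b that] .
    fix x y assume xy: "x \<in> I" "y \<in> I"
    note xc = ideal_closed(1)[OF xy(1)] and yc = ideal_closed(1)[OF xy(2)]
    \<comment> \<open>\<open>x'\<close> is chosen with
      \<open>b \<otimes> x' = x \<otimes> b\<close>, and \<open>y'\<close> so that
      \<open>lam x y'\<close> is \<open>lam x y\<close> conjugated by \<open>lam x b\<close>. The
      element \<open>i\<close> will be the difference of \<open>lam x b\<close> and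
      \<open>b\<close>.\<close>
    define x' where "x' = inv b \<otimes> x \<otimes> b"
    define y' where "y' = b \<oplus> y \<oplus> \<ominus> b"
    define i where "i = \<ominus> x \<oplus> (b \<oplus> lam b x' \<oplus> \<ominus> b)"
    have x': "x' \<in> I" using brace_idealD(6)[OF I, of "inv b" x] b xy by (simp add: x'_def)
    have y': "y' \<in> I" using brace_idealD(5)[OF I b xy(2)] by (simp add: y'_def)
    have i: "i \<in> I"
      using brace_idealD(5)[OF I b ideal_closed(5)[OF b x']] xy by (simp add: i_def ideal_closed)
    note c = b xc yc ideal_closed(1)[OF x'] ideal_closed(1)[OF y'] ideal_closed(1)[OF i] brace_lambda_closed
    \<comment> \<open>\<open>lam x b\<close> and \<open>b\<close> agree modulo \<open>I\<close>, which acts on \<open>I\<close> by conjugation trivially modulo \<open>J\<close>\<close>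
    have "b \<otimes> x' = x \<otimes> b" using c by (simp add: x'_def mult.m_assoc mult_inv_cancel)
    then have "x \<oplus> lam x b = b \<oplus> lam b x'"
      using c by (simp flip: mult_eq_add_lambda)
    then have "\<ominus> x \<oplus> (x \<oplus> lam x b) = \<ominus> x \<oplus> (b \<oplus> lam b x')" by simp
    then have lb: "lam x b = i \<oplus> b"
      using c by (simp add: i_def add_group_simps)
    define w where "w = b \<oplus> lam x y \<oplus> \<ominus> b"
    have w: "w \<in> I" using brace_idealD(5)[OF I b ideal_closed(5)[OF xc xy(2)]] by (simp add: w_def)
    have "lam x y' = i \<oplus> w \<oplus> \<ominus> i"
      using c by (simp add: y'_def w_def lambda_add lambda_neg lb add_group_simps)
    moreover obtain j where j: "j \<in> J" "i \<oplus> w = j \<oplus> w \<oplus> i" using commute_mod[OF i w] .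
    moreover have jc: "j \<in> carrier B" using j JI ideal_closed(1) by blast
    ultimately have "lam x y' = j \<oplus> w" using c ideal_closed(1)[OF w] by (simp add: add_group_simps)
    then have "b \<oplus> (lam x y \<oplus> \<ominus> y) \<oplus> \<ominus> b = \<ominus> j \<oplus> (lam x y' \<oplus> \<ominus> y')"
      using c jc ideal_closed(1)[OF w] by (simp add: y'_def w_def add_group_simps)
    then show "b \<oplus> (lam x y \<oplus> \<ominus> y) \<oplus> \<ominus> b \<in> ideal_square I J"
      using ideal_square_incl(1)[OF j(1)] ideal_square_incl(2)[OF xy(1) y'] ideal_square_subgroup
      by (simp add: add_subgroup_iff)
  qed
qed

text \<open>Modulo \<open>ideal_square I J\<close> the two operations agree on \<open>I\<close> and
  addition is commutative there, so multiplication is commutative as well.\<close>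

lemma brace_commutator_subset_ideal_square: "brace_commutator B I I \<subseteq> ideal_square I J"
proof -
  let ?K = "ideal_square I J"
  note K = ideal_square_ideal
  have Ks: "x \<in> ?K \<Longrightarrow> y \<in> ?K \<Longrightarrow> x \<oplus> y \<in> ?K" "x \<in> ?K \<Longrightarrow> \<ominus> x \<in> ?K" "x \<in> ?K \<Longrightarrow> x \<in> carrier B" for x y
    using ideal_square_subgroup by (auto simp: add_subgroup_iff)
  have op: "x \<otimes> y \<oplus> \<ominus> (x \<oplus> y) \<in> ?K" if "x \<in> I" "y \<in> I" for x y
  proof -
    have "x \<otimes> y \<oplus> \<ominus> (x \<oplus> y) = x \<oplus> (lam x y \<oplus> \<ominus> y) \<oplus> \<ominus> x"
      using that ideal_closed(1) by (simp add: mult_eq_add_lambda brace_lambda_closed add_group_simps)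
    then show ?thesis
      using brace_idealD(5)[OF K ideal_closed(1) ideal_square_incl(2)] that by simp
  qed
  have "x \<otimes> y \<otimes> inv x \<otimes> inv y \<in> ?K" if xy: "x \<in> I" "y \<in> I" for x y
  proof -
    note c = ideal_closed(1)[OF xy(1)] ideal_closed(1)[OF xy(2)]
    define p where "p = x \<otimes> y \<oplus> \<ominus> (x \<oplus> y)"
    define q where "q = y \<otimes> x \<oplus> \<ominus> (y \<oplus> x)"
    define r where "r = x \<oplus> y \<oplus> \<ominus> x \<oplus> \<ominus> y"
    \<comment> \<open>Obtained from \<open>x \<otimes> y = p \<oplus> x \<oplus> y\<close>,
      \<open>x \<oplus> y = r \<oplus> y \<oplus> x\<close> and
      \<open>y \<otimes> x = q \<oplus> y \<oplus> x\<close>.\<close>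
    define k where "k = p \<oplus> r \<oplus> \<ominus> q"
    have "p \<in> ?K" "q \<in> ?K" "r \<in> ?K"
      using op xy ideal_square_incl(1)[OF commutator_mem] by (simp_all add: p_def q_def r_def)
    then have k: "k \<in> ?K" by (simp add: k_def Ks)
    have e: "x \<otimes> y = k \<oplus> y \<otimes> x"
      using c by (simp add: k_def p_def q_def r_def add_group_simps)
    let ?v = "y \<otimes> x"
    have v: "?v \<in> carrier B" using c by simp
    \<comment> \<open>The summand \<open>k\<close> is moved to the right of \<open>?v\<close> and
      then turned into a multiplicative right factor by \<open>lam (inv ?v)\<close>; the commutator
      becomes a multiplicative conjugate of an element of \<open>?K\<close>.\<close>
    define k' where "k' = \<ominus> ?v \<oplus> k \<oplus> \<ominus> (\<ominus> ?v)"
    have k': "k' \<in> ?K" using brace_idealD(5)[OF K _ k, of "\<ominus> ?v"] v by (simp only: k'_def neg_closed)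
    have "x \<otimes> y = ?v \<oplus> k'" using e v Ks(3)[OF k] by (simp add: k'_def add_group_simps)
    also have "\<dots> = ?v \<oplus> lam ?v (lam (inv ?v) k')"
      using v Ks(3)[OF k'] by (simp add: lambda_mult[symmetric] lambda_one del: mult.inv_mult_group)
    also have "\<dots> = ?v \<otimes> lam (inv ?v) k'"
      using v Ks(3)[OF k'] by (simp add: mult_eq_add_lambda brace_lambda_closed)
    finally have "x \<otimes> y \<otimes> inv ?v = ?v \<otimes> lam (inv ?v) k' \<otimes> inv ?v" by simp
    moreover have "\<dots> \<in> ?K"
      using brace_idealD(6)[OF K v brace_idealD(4)[OF K _ k']] v by blast
    ultimately show ?thesis using c by (simp add: mult.inv_mult_group mult.m_assoc)
  qed
  then have "derived B I \<subseteq> ?K"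
    unfolding derived_def using brace_idealD(2)[OF K] by (intro mult.generate_subgroup_incl) auto
  moreover have "derived (add_monoid B) I \<subseteq> ?K" using IJ ideal_square_incl(1) by blast
  ultimately have "derived (add_monoid B) I \<union> derived B I \<union>
      {x \<otimes> y \<ominus> (x \<oplus> y) |x y. x \<in> I \<and> y \<in> I} \<subseteq> ?K"
    using op by (auto simp: a_minus_def)
  then show ?thesis
    using K by (auto simp: brace_commutator_def brace_ideal_generated_def commutator_subgroup_self)
qed

text \<open>Finiteness provides a maximal proper subgroup \<open>M\<close> of \<open>I\<close> that
  contains \<open>J\<close> and is stable under \<open>lam x\<close> for \<open>x \<in> I\<close>;
  every generator of the square is shown to lie in it.\<close>

lemma ideal_square_proper:
  assumes fin: "finite I" and ne: "J \<noteq> I"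
  shows "ideal_square I J \<subset> I"
proof -
  define stable where "stable M \<longleftrightarrow> subgroup M (add_monoid B) \<and> J \<subseteq> M \<and> M \<subset> I \<and>
    (\<forall>x\<in>I. \<forall>k\<in>M. lam x k \<in> M)" for M
  have "stable J" using brace_idealD[OF J] JI ne ideal_closed(1) by (auto simp: stable_def)
  then have "Collect stable \<noteq> {}" by blast
  moreover have "finite (Collect stable)"
    by (rule finite_subset[of _ "Pow I"]) (use fin in \<open>auto simp: stable_def\<close>)
  ultimately obtain M where M_in: "M \<in> Collect stable"
    and M_max: "\<forall>M'\<in>Collect stable. M \<subseteq> M' \<longrightarrow> M = M'"
    using finite_has_maximal[of "Collect stable"] by metis
  have M: "subgroup M (add_monoid B)" "J \<subseteq> M" "M \<subset> I" "\<And>x k. \<lbrakk> x \<in> I; k \<in> M \<rbrakk> \<Longrightarrow> lam x k \<in> M"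
    using M_in by (simp_all add: stable_def)
  have Ms: "x \<in> M \<Longrightarrow> y \<in> M \<Longrightarrow> x \<oplus> y \<in> M" "x \<in> M \<Longrightarrow> \<ominus> x \<in> M" "\<zero> \<in> M"
    "x \<in> M \<Longrightarrow> x \<in> I" "x \<in> J \<Longrightarrow> x \<in> M" for x y
    using M by (auto simp: add_subgroup_iff)
  have "lam x m \<oplus> \<ominus> m \<in> M" if x: "x \<in> I" and m: "m \<in> I" for x m
  proof (cases "m \<in> M")
    case True
    then show ?thesis using M x by (simp add: Ms)
  next
    case False
    \<comment> \<open>For fixed \<open>m\<close> this is right multiplication by \<open>m\<close> in
      the ring \<open>I/J\<close>; \<open>g_add\<close> is its additivity up to
      \<open>J\<close>.\<close>
    define g where "g y = lam y m \<oplus> \<ominus> m" for y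
    have gI: "g y \<in> I" if "y \<in> I" for y using that m by (simp add: g_def ideal_closed)
    have mc: "m \<in> carrier B" using m ideal_closed(1) by simp
    have g_add: "\<exists>j\<in>J. g (y \<oplus> z) = j \<oplus> (g y \<oplus> g z)" if y: "y \<in> I" and z: "z \<in> I" for y z
    proof -
      note c = ideal_closed(1)[OF y] ideal_closed(1)[OF z] mc brace_lambda_closed
      \<comment> \<open>This is right distributivity; moving \<open>\<ominus> z\<close> past
        \<open>g y\<close> then costs only an element of \<open>J\<close>.\<close>
      have "g (y \<oplus> z) = \<ominus> z \<oplus> g y \<oplus> z \<oplus> g z"
        using c by (simp add: g_def brace_lambda_def brace_right_distrib add_group_simps)
      moreover obtain j where j: "j \<in> J" "\<ominus> z \<oplus> g y = j \<oplus> g y \<oplus> \<ominus> z"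
        using commute_mod[OF ideal_closed(3)[OF z] gI[OF y]] .
      moreover have "j \<in> carrier B" "g y \<in> carrier B" "g z \<in> carrier B"
        using j(1) JI gI y z ideal_closed(1) by blast+
      ultimately show ?thesis using c by (auto simp: add_group_simps)
    qed
    \<comment> \<open>By maximality of \<open>M\<close>, the submodule \<open>T\<close> is \<open>M\<close> or \<open>I\<close>. In the latter case \<open>-m\<close> is congruent
      to \<open>g y = lam y m - m\<close> modulo \<open>M\<close> for some \<open>y\<close>, so \<open>lam y m\<close> and hence \<open>m\<close> lies in \<open>M\<close>.\<close>
    define T where "T = {k \<oplus> g y | k y. k \<in> M \<and> y \<in> I}"
    have g0: "g \<zero> = \<zero>" using mc lambda_one[of m] by (simp add: g_def one_eq_zero)
    have TI: "T \<subseteq> I" using gI Ms(4) ideal_closed(2) by (auto simp: T_def)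
    have MT: "M \<subseteq> T"
    proof
      fix k assume "k \<in> M"
      then have "k = k \<oplus> g \<zero>" "k \<in> M" using g0 Ms(4) ideal_closed(1) by auto
      then show "k \<in> T" unfolding T_def using ideal_closed(4) by blast
    qed
    \<comment> \<open>The errors \<open>j\<close> and \<open>j'\<close> lie in \<open>J\<close>,
      hence in \<open>M\<close>, and are absorbed into the first summand.\<close>
    have T_add: "u \<oplus> v \<in> T" if "u \<in> T" "v \<in> T" for u v
    proof -
      obtain k y where u: "u = k \<oplus> g y" "k \<in> M" "y \<in> I"
        using \<open>u \<in> T\<close> by (auto simp: T_def)
      obtain l z where v: "v = l \<oplus> g z" "l \<in> M" "z \<in> I"
        using \<open>v \<in> T\<close> by (auto simp: T_def)
      note kl = u v
      obtain j where j: "j \<in> J" "g y \<oplus> l = j \<oplus> l \<oplus> g y"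
        using commute_mod[OF gI Ms(4)] kl by blast
      obtain j' where j': "j' \<in> J" "g (y \<oplus> z) = j' \<oplus> (g y \<oplus> g z)"
        using g_add[OF kl(3,6)] by blast
      have c: "k \<in> carrier B" "l \<in> carrier B" "g y \<in> carrier B" "g z \<in> carrier B" "j \<in> carrier B" "j' \<in> carrier B"
        using kl gI Ms(4,5) j(1) j'(1) ideal_closed(1) by blast+
      have "u \<oplus> v = k \<oplus> (g y \<oplus> l) \<oplus> g z" using c kl by (simp add: add_group_simps)
      also have "\<dots> = (k \<oplus> j \<oplus> l \<oplus> \<ominus> j') \<oplus> g (y \<oplus> z)"
        using c j j' by (simp add: add_group_simps)
      finally have "u \<oplus> v = (k \<oplus> j \<oplus> l \<oplus> \<ominus> j') \<oplus> g (y \<oplus> z)" .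
      moreover have "k \<oplus> j \<oplus> l \<oplus> \<ominus> j' \<in> M" using kl j(1) j'(1) by (simp add: Ms)
      moreover have "y \<oplus> z \<in> I" using kl ideal_closed(2) by simp
      ultimately show ?thesis unfolding T_def by blast
    qed
    have T_neg: "\<ominus> u \<in> T" if "u \<in> T" for u
    proof -
      obtain k y where k: "u = k \<oplus> g y" "k \<in> M" "y \<in> I" using \<open>u \<in> T\<close> by (auto simp: T_def)
      obtain j where j: "j \<in> J" "g (\<ominus> y \<oplus> y) = j \<oplus> (g (\<ominus> y) \<oplus> g y)"
        using g_add[OF ideal_closed(3)] k by blast
      have c: "k \<in> carrier B" "y \<in> carrier B" "g y \<in> carrier B" "g (\<ominus> y) \<in> carrier B" "j \<in> carrier B"
        using k gI Ms(4,5) j(1) ideal_closed(1,3) by blast+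
      then have "\<zero> = j \<oplus> g (\<ominus> y) \<oplus> g y" using j(2) g0 by (simp add: add_group_simps)
      then have "\<zero> \<oplus> \<ominus> g y = j \<oplus> g (\<ominus> y) \<oplus> g y \<oplus> \<ominus> g y" by simp
      then have "\<ominus> g y = j \<oplus> g (\<ominus> y)" using c by (simp add: add_group_simps)
      then have "\<ominus> u = (j \<oplus> g (\<ominus> y)) \<oplus> \<ominus> k" using c k by (simp add: neg_add)
      moreover have "j \<oplus> g (\<ominus> y) \<in> T" using Ms(5)[OF j(1)] ideal_closed(3)[OF k(3)] by (auto simp: T_def)
      moreover have "\<ominus> k \<in> T" using MT Ms(2)[OF k(2)] by blast
      ultimately show ?thesis using T_add by simp
    qed
    have T_sub: "subgroup T (add_monoid B)"
      using T_add T_neg MT Ms(3) TI ideal_closed(1) by (auto simp: add_subgroup_iff)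
    have T_lam: "lam z u \<in> T" if z: "z \<in> I" and "u \<in> T" for z u
    proof -
      obtain k y where k: "u = k \<oplus> g y" "k \<in> M" "y \<in> I" using \<open>u \<in> T\<close> by (auto simp: T_def)
      note c = ideal_closed(1)[OF z] ideal_closed(1)[OF k(3)] mc brace_lambda_closed ideal_closed(1)[OF Ms(4)[OF k(2)]]
      \<comment> \<open>By \<open>lambda_mult\<close>, the image of \<open>g y\<close> is
        \<open>g (z \<otimes> y) \<oplus> \<ominus> g z\<close>. The summand \<open>\<zero>\<close>
        gives \<open>g z\<close> the form required by \<open>T\<close>.\<close>
      have "lam z u = (lam z k \<oplus> g (z \<otimes> y)) \<oplus> \<ominus> (\<zero> \<oplus> g z)"
        using c k by (simp add: g_def lambda_add lambda_neg lambda_mult add_group_simps)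
      moreover have "lam z k \<oplus> g (z \<otimes> y) \<in> T"
        using M(4)[OF z k(2)] ideal_closed(6)[OF z k(3)] unfolding T_def by blast
      moreover have "\<zero> \<oplus> g z \<in> T" using Ms(3) z unfolding T_def by blast
      ultimately show ?thesis using T_add T_neg by simp
    qed
    have "T = M"
    proof (cases "T = I")
      case True
      then obtain k y where k: "\<ominus> m = k \<oplus> g y" "k \<in> M" "y \<in> I"
        using ideal_closed(3)[OF m] unfolding T_def by blast
      note c = mc ideal_closed(1)[OF k(3)] ideal_closed(1)[OF Ms(4)[OF k(2)]] brace_lambda_closed
      have "\<ominus> m \<oplus> m = k \<oplus> g y \<oplus> m" using k(1) by simp
      then have "\<zero> = k \<oplus> lam y m" using c by (simp add: g_def add_group_simps)
      then have "\<ominus> k \<oplus> \<zero> = \<ominus> k \<oplus> (k \<oplus> lam y m)" by simp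
      then have l: "lam y m = \<ominus> k" using c by (simp add: add_group_simps)
      have "inv y \<in> I" using brace_idealD(2)[OF I] k(3) by (rule subgroup.m_inv_closed)
      then have "lam (inv y) (lam y m) \<in> M" unfolding l using M k(2) Ms(2) by blast
      then have "m \<in> M" using c by (simp add: lambda_mult[symmetric] lambda_one)
      then show ?thesis using False by blast
    next
      case False
      then show ?thesis using M_max MT M(2) T_sub TI T_lam
        by (metis (no_types, lifting) mem_Collect_eq order_trans psubsetI stable_def)
    qed
    \<comment> \<open>With first summand \<open>\<zero>\<close>, the generator \<open>g x\<close>
      itself lies in \<open>T = M\<close>.\<close>
    moreover have "\<zero> \<oplus> g x \<in> T" using Ms(3) x by (auto simp: T_def)
    ultimately show ?thesis using gI[OF x] ideal_closed(1) by (simp add: g_def)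
  qed
  then have "ideal_square I J \<subseteq> M" using M by (intro ideal_square_minimal) auto
  then show ?thesis using M by blast
qed

end

section \<open>Descent of the brace derived series\<close>

lemma brace_commutator_mono:
  assumes "I \<subseteq> I'"
  shows "brace_commutator B I I \<subseteq> brace_commutator B I' I'"
  unfolding brace_commutator_def brace_ideal_generated_def commutator_subgroup_self
  using add.mono_derived[OF assms] mult.mono_derived[OF assms] assms by (intro Inter_anti_mono) blast

text \<open>As long as \<open>J \<noteq> I\<close>, the ideal \<open>I\<close> can be replaced by
  \<open>ideal_square I J\<close>, which is strictly smaller, still contains \<open>J\<close> and
  contains the next term of the series.\<close>

lemma brace_derived_series_descend:
  assumes "finite I" "brace_ideal B I" "brace_ideal B J" "J \<subseteq> I" "derived (add_monoid B) I \<subseteq> J"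
    and "brace_derived_series B n \<subseteq> I"
  shows "\<exists>m. brace_derived_series B m \<subseteq> J"
  using assms
proof (induction I arbitrary: n rule: finite_psubset_induct)
  case (psubset I)
  show ?case
  proof (cases "J = I")
    case False
    let ?K = "ideal_square I J"
    note * = psubset.prems(1-4)
    have KI: "?K \<subset> I" using ideal_square_proper[OF * psubset.hyps False] .
    have "brace_derived_series B (Suc n) \<subseteq> ?K"
      using brace_commutator_mono[OF psubset.prems(5)] brace_commutator_subset_ideal_square[OF *] by simp
    moreover have "derived (add_monoid B) ?K \<subseteq> J"
      using add.mono_derived[of ?K I] KI *(4) by auto
    ultimately show ?thesis
      using psubset.IH[OF KI ideal_square_ideal[OF *] *(2)] ideal_square_incl(1)[OF *] by blast
  qed (use psubset.prems in blast)
qed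

lemma solvable_add_imp_brace_solvable:
  assumes "finite (carrier B)" and "solvable (add_monoid B)"
  shows "brace_solvable B"
proof -
  let ?D = "\<lambda>n. (derived (add_monoid B) ^^ n) (carrier B)"
  \<comment> \<open>Each induction step descends through the additively abelian factor of
    \<open>?D n\<close> by \<open>?D (Suc n)\<close>.\<close>
  have "\<exists>m. brace_derived_series B m \<subseteq> ?D n" for n
  proof (induction n)
    case 0
    show ?case by (auto intro: exI[of _ 0])
  next
    case (Suc n)
    have D: "brace_ideal B (?D n)" "brace_ideal B (?D (Suc n))" by (rule exp_of_derived_ideal)+
    have "?D (Suc n) \<subseteq> ?D n"
      using add.derived_incl[OF subset_refl brace_idealD(1)[OF D(1)]] by simp
    moreover have "finite (?D n)" using brace_idealD(3)[OF D(1)] assms(1) by (rule finite_subset)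
    ultimately show ?case using Suc brace_derived_series_descend[of "?D n" "?D (Suc n)"] D by auto
  qed
  moreover obtain n where "?D n = {\<zero>}"
    using assms(2) unfolding add.solvable_iff_trivial_derived_seq by auto
  ultimately obtain m where "brace_derived_series B m \<subseteq> {\<zero>}" by metis
  moreover have "\<zero> \<in> brace_derived_series B m"
    using brace_idealD(1)[OF brace_derived_series_ideal] by (simp add: add_subgroup_iff)
  ultimately show ?thesis by (auto simp: brace_solvable_def)
qed

end

theorem corollary4p7:
  fixes B :: "('a, 'm) ring_scheme"
  assumes "two_sided_skew_brace B"
    and "finite (carrier B)"
  shows "(brace_solvable B \<longleftrightarrow> solvable (add_monoid B)) \<and>
         (solvable (add_monoid B) \<longleftrightarrow> solvable B)"
proof -
  interpret two_sided_skew_brace B by fact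
  show ?thesis
    using brace_solvable_imp_solvable solvable_mult_imp_solvable_add
      solvable_add_imp_brace_solvable[OF assms(2)] by blast
qed

end
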